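(* For all nonnegative integers $n,m,\ell$ and all real $\theta$ with $0\le\theta<\pi/2$, $$P_\ell^{(n,m)}(\cos(2\theta))=\frac{2\,n!\,(\ell+m)!}{\pi\,(\ell+n+m)!}\,\frac{1}{\cos^{m}(\theta)}\int_{\theta}^{\pi/2}\frac{\sin(u)}{\sqrt{\cos^2(\theta)-\cos^2(u)}}\;{}_2F_1\!\left(-m,m;\tfrac12;\frac{\cos(\theta)-\cos(u)}{2\cos(\theta)}\right)C_{2\ell+m}^{(n+1)}(\cos u)\,du .$$
   Context: $P_\ell^{(\alpha,\beta)}$ denotes the Jacobi polynomial of degree $\ell$ in the standard normalization $P_\ell^{(\alpha,\beta)}(x)=\frac{(\alpha+1)_\ell}{\ell!}\,{}_2F_1\left(-\ell,\ell+\alpha+\beta+1;\alpha+1;\frac{1-x}{2}\right)$. $C_k^{(\lambda)}$ denotes the ultraspherical (Gegenbauer) polynomial of degree $k$, with generating function $(1-2xr+r^2)^{-\lambda}=\sum_{k\ge 0}C_k^{(\lambda)}(x)r^k$. ${}_2F_1(a,b;c;x)=\sum_{k\ge0}\frac{(a)_k(b)_k}{(c)_k}\frac{x^k}{k!}$ is the Gauss hypergeometric function, where $(a)_k=a(a+1)\cdots(a+k-1)$; here, since $m$ is a nonnegative integer, ${}_2F_1(-m,m;\frac12;\cdot)$ is a polynomial (equal to the constant $1$ when $m=0$). *)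

theory Defs
  imports "HOL-Analysis.Analysis" "HOL-Computational_Algebra.Formal_Power_Series"
begin

text \<open>The Gauss hypergeometric series. When \<open>a\<close> or \<open>b\<close> is a nonpositive integer (and \<open>c\<close> is not),
  only finitely many terms are nonzero, so no convergence condition is needed.\<close>
definition hyp2F1 :: "real \<Rightarrow> real \<Rightarrow> real \<Rightarrow> real \<Rightarrow> real" where
  "hyp2F1 a b c x =
     (\<Sum>k. pochhammer a k * pochhammer b k / pochhammer c k * (x ^ k / fact k))"

definition jacobi_P :: "nat \<Rightarrow> real \<Rightarrow> real \<Rightarrow> real \<Rightarrow> real" where
  "jacobi_P l \<alpha> \<beta> x =
     pochhammer (\<alpha> + 1) l / fact l *
     hyp2F1 (- real l) (real l + \<alpha> + \<beta> + 1) (\<alpha> + 1) ((1 - x) / 2)"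

text \<open>The expansion of \<open>(1 - 2 x r + r\<^sup>2) powr (- \<mu>)\<close> in powers of \<open>r\<close>, as a formal power series:
  the binomial series \<open>(1 + X) powr (- \<mu>)\<close> composed with \<open>- 2 x X + X\<^sup>2\<close>, whose constant
  term is zero.\<close>
definition gegenbauer_gf :: "real \<Rightarrow> real \<Rightarrow> real fps" where
  "gegenbauer_gf \<mu> x = fps_compose (fps_binomial (- \<mu>)) (fps_X ^ 2 - fps_const (2 * x) * fps_X)"

definition gegenbauer_C :: "nat \<Rightarrow> real \<Rightarrow> real \<Rightarrow> real" where
  "gegenbauer_C k \<mu> x = fps_nth (gegenbauer_gf \<mu> x) k"

end

theory Submission
  imports Defs
begin

text \<open>The substitution \<open>cos u = cos \<theta> cos t\<close> absorbs the singular factor into \<open>dt\<close>, and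
  \<open>2F1(-m, m; 1/2; (1 - cos t) / 2) = cos (m t)\<close> is a Chebyshev polynomial, so the integral becomes
  that of \<open>cos (m t) C(cos \<theta> cos t)\<close> over \<open>[0, \<pi> / 2]\<close>. Expanding the Gegenbauer polynomial in
  powers and integrating termwise yields a polynomial in \<open>cos\<^sup>2 \<theta> = (1 + cos 2\<theta>) / 2\<close>, which
  the Chu-Vandermonde identity identifies with the Jacobi polynomial.\<close>

section \<open>Terminating hypergeometric sums as Chebyshev polynomials\<close>

lemma hyp2F1_terminating:
  "hyp2F1 (- real m) b c x =
     (\<Sum>k\<le>m. pochhammer (- real m) k * pochhammer b k / pochhammer c k * (x ^ k / fact k))"
  unfolding hyp2F1_def
  by (rule suminf_finite) (auto simp: pochhammer_of_nat_eq_0_iff)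

lemma hyp2F1_terminating':
  assumes "m \<le> M"
  shows "hyp2F1 (- real m) b c x =
     (\<Sum>k\<le>M. pochhammer (- real m) k * pochhammer b k / pochhammer c k * (x ^ k / fact k))"
  unfolding hyp2F1_terminating using assms
  by (intro sum.mono_neutral_left) (auto simp: pochhammer_of_nat_eq_0_iff)

text \<open>This is the Chebyshev recurrence at the level of coefficients. All three terms on the
  left are rational multiples of \<open>Q a k\<close>, so only an identity of rational functions in
  \<open>a\<close> and \<open>k\<close> has to be checked.\<close>

lemma pochhammer_neg_pos_second_difference:
  fixes a :: real
  assumes "a \<noteq> 0"
  defines "Q \<equiv> \<lambda>a k. pochhammer (- a) k * pochhammer a k"
  shows "Q (a + 1) (Suc k) - 2 * Q a (Suc k) + Q (a - 1) (Suc k)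
           = - 2 * (2 * real k + 1) * (real k + 1) * Q a k"
proof -
  \<comment> \<open>Shifting the base by one trades the first factor of the product for a new last
    one; removing that first factor is the division by \<open>a\<close>.\<close>
  have p: "pochhammer (a + 1) k = pochhammer a k * (a + real k) / a"
    using assms(1) pochhammer_rec[of a k] pochhammer_rec'[of a k] by (simp add: field_simps)
  have q: "pochhammer (1 - a) k = pochhammer (- a) k * (a - real k) / a"
    using assms(1) pochhammer_rec[of "- a" k] pochhammer_rec'[of "- a" k] by (simp add: field_simps)
  have 1: "Q (a + 1) (Suc k) = - (a + 1) * (a + real k) * (a + 1 + real k) / a * Q a k"
  proof -
    have "pochhammer (- (a + 1)) (Suc k) = - (a + 1) * pochhammer (- a) k"
      using pochhammer_rec[of "- (a + 1)" k] by simp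
    then show ?thesis unfolding Q_def pochhammer_rec'[of "a + 1"] p by simp
  qed
  have 2: "Q (a - 1) (Suc k) = - (a - 1) * (a - real k) * (a - 1 - real k) / a * Q a k"
  proof -
    have "pochhammer (a - 1) (Suc k) = (a - 1) * pochhammer a k"
      using pochhammer_rec[of "a - 1" k] by simp
    moreover have "pochhammer (- (a - 1)) (Suc k) = (1 - a + real k) * (pochhammer (- a) k * (a - real k) / a)"
      using pochhammer_rec'[of "1 - a" k] by (simp add: q)
    ultimately show ?thesis unfolding Q_def by (simp only:) (simp add: algebra_simps)
  qed
  have 3: "Q a (Suc k) = (real k - a) * (a + real k) * Q a k"
    unfolding Q_def pochhammer_rec' by (simp add: algebra_simps)
  have "- (a + 1) * (a + real k) * (a + 1 + real k) / a - 2 * ((real k - a) * (a + real k))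
      + - (a - 1) * (a - real k) * (a - 1 - real k) / a = - 2 * (2 * real k + 1) * (real k + 1)"
    using assms(1) by (simp add: field_simps)
  then show ?thesis unfolding 1 2 3 by (metis (no_types, lifting) distrib_right left_diff_distrib mult.assoc)
qed

text \<open>With \<open>x = 1 - 2 * z\<close> this is T_(m+1) = 2 x T_m - T_(m-1). It follows by
  comparing coefficients of \<open>z ^ Suc k\<close>.\<close>

lemma hyp2F1_chebyshev_rec:
  assumes "m > 0"
  defines "g \<equiv> \<lambda>m z. hyp2F1 (- real m) (real m) (1 / 2) z"
  shows "g (Suc m) z = 2 * (1 - 2 * z) * g m z - g (m - 1) z"
proof -
  define a where "a = (\<lambda>m k. pochhammer (- real m) k * pochhammer (real m) k / pochhammer (1/2) k / fact k)"
  have g: "g j z = (\<Sum>k\<le>M. a j k * z ^ k)" if "j \<le> M" for j M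
    unfolding g_def a_def hyp2F1_terminating'[OF that] by simp
  \<comment> \<open>All three polynomials are padded to one common range, and the constant term 1 is
    split off: in the second difference it cancels as 1 - 2 + 1.\<close>
  have g': "g j z = 1 + (\<Sum>k\<le>Suc m. a j (Suc k) * z ^ Suc k)" if "j \<le> Suc m" for j
    using that by (subst g[of _ "Suc (Suc m)"]) (auto simp: sum.atMost_Suc_shift a_def simp del: sum.atMost_Suc)
  have rec: "a (Suc m) (Suc k) - 2 * a m (Suc k) + a (m - 1) (Suc k) = - 4 * a m k" for k
  proof -
    define D :: real where "D = pochhammer (1/2) (Suc k) * fact (Suc k)"
    have D: "D = (1/2 + real k) * (real k + 1) * (pochhammer (1/2) k * fact k)"
      unfolding D_def pochhammer_rec' by (simp add: algebra_simps)
    have nz: "pochhammer (1/2::real) k \<noteq> 0"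
      using pochhammer_pos[of "1/2::real" k] by simp
    have "a (Suc m) (Suc k) - 2 * a m (Suc k) + a (m - 1) (Suc k)
       = - 2 * (2 * real k + 1) * (real k + 1) * (pochhammer (- real m) k * pochhammer (real m) k) / D"
      using pochhammer_neg_pos_second_difference[of "real m" k] assms(1)
      unfolding a_def D_def
      by (simp add: of_nat_diff add_divide_distrib[symmetric] diff_divide_distrib[symmetric] add.commute)
    also have "\<dots> = - 4 * a m k"
      unfolding a_def D using nz by (simp add: divide_simps) (simp add: algebra_simps)
    finally show ?thesis .
  qed
  have "g (Suc m) z - 2 * g m z + g (m - 1) z
      = (\<Sum>k\<le>Suc m. (a (Suc m) (Suc k) - 2 * a m (Suc k) + a (m - 1) (Suc k)) * z ^ Suc k)"
    by (simp add: g' sum.distrib sum_subtractf sum_distrib_left algebra_simps del: sum.atMost_Suc)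
  \<comment> \<open>The index shift leaves one factor \<open>z\<close>; moving
    \<open>2 * g m z\<close> across then gives 2 - 4 z = 2 (1 - 2 z).\<close>
  also have "\<dots> = - 4 * z * g m z"
    unfolding rec by (simp add: g[of m "Suc m"] sum_distrib_left algebra_simps del: sum.atMost_Suc)
  finally show ?thesis by (simp add: algebra_simps)
qed

text \<open>\<open>cos (real m * t)\<close> obeys the same recurrence, by the product-to-sum
  formula, and has the same values for \<open>m = 0\<close> and \<open>m = 1\<close>. The induction
  is strong because the recurrence reaches back two steps.\<close>

lemma hyp2F1_chebyshev:
  "hyp2F1 (- real m) (real m) (1 / 2) ((1 - cos t) / 2) = cos (real m * t)"
proof (induction m rule: less_induct)
  case (less m)
  consider "m = 0" | "m = 1" | j where "m = Suc j" "j > 0"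
    by (metis One_nat_def not0_implies_Suc not_gr0)
  then show ?case
  proof cases
    case 1
    then show ?thesis using hyp2F1_terminating[of 0] by simp
  next
    case 2
    then show ?thesis using hyp2F1_terminating[of 1 1 "1 / 2" "(1 - cos t) / 2"] by (simp add: field_simps)
  next
    case 3
    have "cos (real m * t) = 2 * cos t * cos (real j * t) - cos (real (j - 1) * t)"
      using 3 cos_times_cos[of t "real j * t"]
      by (simp add: of_nat_diff algebra_simps) (metis cos_minus minus_diff_eq)
    with 3 show ?thesis
      using hyp2F1_chebyshev_rec[of j "(1 - cos t) / 2"] less[of j] less[of "j - 1"]
      by (simp add: right_diff_distrib diff_divide_distrib)
  qed
qed

section \<open>Gegenbauer polynomials in powers, and cosine moments\<close>

text \<open>The inner series factors as X (X - 2 x), so the k-th coefficient of its i-th power is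
  coefficient \<open>k - i\<close> of a binomial power. Truncation in \<open>2 * i - k\<close> is
  harmless: for \<open>2 * i < k\<close> the factor \<open>i choose (k - i)\<close> is 0.\<close>

lemma gegenbauer_C_eq_sum:
  "gegenbauer_C k \<mu> x =
     (\<Sum>i\<le>k. ((- \<mu>) gchoose i) * of_nat (i choose (k - i)) * (- 2 * x) ^ (2 * i - k))"
proof -
  have "fps_nth ((fps_X ^ 2 - fps_const (2 * x) * fps_X) ^ i) k =
          of_nat (i choose (k - i)) * (- 2 * x) ^ (2 * i - k)" if "i \<le> k" for i
  proof -
    have "(fps_X ^ 2 - fps_const (2 * x) * fps_X :: real fps) ^ i
        = fps_X ^ i * (fps_X + fps_const (- 2 * x)) ^ i"
      by (simp flip: power_mult_distrib fps_const_neg add: power2_eq_square algebra_simps)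
    also have "fps_nth \<dots> k = fps_nth ((fps_X + fps_const (- 2 * x)) ^ i) (k - i)"
      using that by (simp add: fps_X_power_mult_nth)
    also have "\<dots> = (\<Sum>j\<le>i. if j = k - i then of_nat (i choose j) * (- 2 * x) ^ (i - j) else 0)"
      unfolding binomial_ring fps_sum_nth
      by (rule sum.cong)
         (auto simp: fps_const_power fps_mult_right_const_nth fps_of_nat[symmetric] fps_X_power_nth mult.assoc)
    also have "\<dots> = of_nat (i choose (k - i)) * (- 2 * x) ^ (2 * i - k)"
    proof (cases "k - i \<le> i")
      case True
      then have "i - (k - i) = 2 * i - k" using that by simp
      then show ?thesis using True by simp
    qed (simp add: binomial_eq_0)
    finally show ?thesis .
  qed
  then show ?thesis
    unfolding gegenbauer_C_def gegenbauer_gf_def fps_compose_nth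
    by (auto simp: atLeast0AtMost mult.assoc intro!: sum.cong)
qed

text \<open>With the frequency written as \<open>p - 2 r\<close>, also for \<open>r > p\<close> where the binomial vanishes,
  the induction step is Pascal's rule.\<close>
lemma has_integral_cos_mult_cos_power:
  "((\<lambda>t. cos ((real p - 2 * real r) * t) * cos t ^ p) has_integral
      pi / 2 ^ (p + 1) * real (p choose r)) {0..pi / 2}"
proof (induction p arbitrary: r)
  case 0
  show ?case
  proof (cases "r = 0")
    case True
    then show ?thesis using has_integral_const_real[of "1::real" 0 "pi/2"] by simp
  next
    case False
    \<comment> \<open>The antiderivative sin(2 r t) / (2 r) vanishes at both ends, since sin(r pi) =
      0.\<close>
    have "((\<lambda>t. cos (- (2 * real r * t))) has_integral
            sin (2 * real r * (pi / 2)) / (2 * real r) - sin (2 * real r * 0) / (2 * real r)) {0..pi / 2}"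
      using False
      by (intro fundamental_theorem_of_calculus)
         (auto intro!: derivative_eq_intros simp flip: has_real_derivative_iff_has_vector_derivative)
    then show ?thesis using False by (simp add: binomial_eq_0)
  qed
next
  case (Suc p)
  \<comment> \<open>Product-to-sum spends one factor \<open>cos t\<close> and moves the frequency up
    and down by one. The index \<open>real r - 1\<close> is a real number, so \<open>r = 0\<close>
    is covered too.\<close>
  have split: "cos ((real (Suc p) - 2 * real r) * t) * cos t ^ Suc p
      = (cos ((real p - 2 * (real r - 1)) * t) * cos t ^ p + cos ((real p - 2 * real r) * t) * cos t ^ p) / 2" for t
  proof -
    have "(real (Suc p) - 2 * real r) * t - t = (real p - 2 * real r) * t"
      "(real (Suc p) - 2 * real r) * t + t = (real p - 2 * (real r - 1)) * t"
      by (simp_all add: algebra_simps)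
    then have "cos ((real (Suc p) - 2 * real r) * t) * cos t
        = (cos ((real p - 2 * (real r - 1)) * t) + cos ((real p - 2 * real r) * t)) / 2"
      by (simp only: cos_times_cos add.commute)
    then show ?thesis by (simp only: power_Suc mult.assoc[symmetric]) (simp add: distrib_right)
  qed
  \<comment> \<open>By Pascal's rule the difference is \<open>p choose (r - 1)\<close> for positive
    \<open>r\<close>; for \<open>r = 0\<close> it is 0.\<close>
  have "((\<lambda>t. cos ((real p - 2 * (real r - 1)) * t) * cos t ^ p) has_integral
      pi / 2 ^ (p + 1) * (real (Suc p choose r) - real (p choose r))) {0..pi / 2}"
  proof (cases r)
    case 0
    \<comment> \<open>Cosine is even, so frequency p + 2 may be replaced by -(p + 2), which is the
      induction hypothesis at index \<open>Suc p\<close>, where the binomial is 0.\<close>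
    have "cos ((real p + 2) * t) = cos ((real p - 2 * real (Suc p)) * t)" for t
      by (subst cos_minus[symmetric]) (simp add: algebra_simps)
    then show ?thesis using Suc[of "Suc p"] 0 by (simp add: binomial_eq_0)
  next
    case (Suc q)
    then show ?thesis using Suc.IH[of q] by simp
  qed
  from has_integral_divide[OF has_integral_add[OF this Suc[of r]], of 2]
  show ?case unfolding split by (rule has_integral_eq_rhs) (simp add: field_simps)
qed

section \<open>Jacobi polynomials with natural parameters, in powers of (1 - x) / 2 and of (1 + x) /
  2\<close>

lemma gbinomial_minus_Suc:
  "(- (real n + 1)) gchoose i = (- 1) ^ i * real ((n + i) choose i)"
  using gbinomial_minus[of "real n + 1" i] by (simp add: binomial_gbinomial add_ac)

lemma pochhammer_real_Suc: "pochhammer (real n + 1) k = fact (n + k) / fact n"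
  by (induction k) (simp_all add: pochhammer_rec' algebra_simps)

lemma pochhammer_minus_real:
  assumes "k \<le> l"
  shows "pochhammer (- real l) k = (- 1) ^ k * fact l / fact (l - k)"
  using pochhammer_minus[of "real l" k] pochhammer_real_Suc[of "l - k" k] assms
  by (simp add: of_nat_diff)

text \<open>For natural parameters every Pochhammer symbol is, up to sign, a quotient of factorials;
  those without \<open>m\<close> combine to (n+l)! / ((l-s)! (n+s)!) and a factor 1 / s!.\<close>

lemma jacobi_P_eq_sum:
  "jacobi_P l (real n) (real m) x =
     (\<Sum>s\<le>l. (- 1) ^ s * real ((n + l) choose (l - s)) * fact (l + n + m + s)
        / (fact (l + n + m) * fact s) * ((1 - x) / 2) ^ s)"
proof -
  have "pochhammer (real n + 1) l / fact l *
      (pochhammer (- real l) s * pochhammer (real l + real n + real m + 1) s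
         / pochhammer (real n + 1) s * (((1 - x) / 2) ^ s / fact s))
    = (- 1) ^ s * real ((n + l) choose (l - s)) * fact (l + n + m + s)
        / (fact (l + n + m) * fact s) * ((1 - x) / 2) ^ s" if "s \<le> l" for s
  proof -
    have N: "real l + real n + real m + 1 = real (l + n + m) + 1" by simp
    show ?thesis
      unfolding N pochhammer_real_Suc pochhammer_minus_real[OF that]
      using that by (simp add: binomial_fact field_simps)
  qed
  then show ?thesis
    unfolding jacobi_P_def hyp2F1_terminating sum_distrib_left by (intro sum.cong) auto
qed

text \<open>Negating the upper argument of the second binomial absorbs the sign (-1)^j and makes the
  sum a Chu-Vandermonde convolution. The upper arguments add up to -(n + s + 1), and a second
  negation returns to natural numbers.\<close>

lemma sum_alternating_binomial_product:
  assumes "s \<le> l"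
  shows "(\<Sum>j\<le>l - s. (- 1) ^ (l - s + j) * real ((l + m) choose (l - s - j)) * real ((l + n + m + s + j) choose j))
       = real ((n + l) choose (l - s))"
proof -
  have "(\<Sum>j\<le>l - s. (- 1) ^ (l - s + j) * real ((l + m) choose (l - s - j)) * real ((l + n + m + s + j) choose j))
      = (- 1) ^ (l - s) * (\<Sum>j = 0..l - s. (- (real (l + n + m + s) + 1) gchoose j) * (real (l + m) gchoose (l - s - j)))"
    unfolding gbinomial_minus_Suc binomial_gbinomial[of "l + m"] sum_distrib_left
    by (simp add: atLeast0AtMost power_add mult_ac)
  also have "\<dots> = (- 1) ^ (l - s) * (- (real (n + s) + 1) gchoose (l - s))"
    unfolding gbinomial_Vandermonde by (simp add: algebra_simps)
  also have "\<dots> = real ((n + l) choose (l - s))"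
    unfolding gbinomial_minus_Suc using assms by (simp flip: power_add mult.assoc)
  finally show ?thesis .
qed

text \<open>The reflection \<open>P\<^sub>l\<^sup>(\<^sup>\<alpha>\<^sup>,\<^sup>\<beta>\<^sup>)(x) = (-1)\<^sup>l P\<^sub>l\<^sup>(\<^sup>\<beta>\<^sup>,\<^sup>\<alpha>\<^sup>)(-x)\<close>, written out in powers of \<open>(1 + x) / 2\<close>.\<close>
lemma jacobi_P_reflected:
  "jacobi_P l (real n) (real m) x =
     (\<Sum>i\<le>l. (- 1) ^ (l + i) * fact (l + n + m + i) * fact (l + m)
        / (fact (l + n + m) * fact (l - i) * fact i * fact (m + i)) * ((1 + x) / 2) ^ i)"
proof -
  define z where "z = (1 - x) / 2"
  define B :: "nat \<Rightarrow> real" where "B i = (- 1) ^ (l + i) * fact (l + n + m + i) * fact (l + m)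
        / (fact (l + n + m) * fact (l - i) * fact i * fact (m + i))" for i
  \<comment> \<open>Since (1 + x) / 2 = 1 - z, this is the coefficient of \<open>(- z) ^ s\<close>
    after binomial expansion; it has to match the one in \<open>jacobi_P_eq_sum\<close>.\<close>
  have coeff: "(\<Sum>i\<le>l. B i * real (i choose s))
      = real ((n + l) choose (l - s)) * (fact (l + n + m + s) / (fact (l + n + m) * fact s))"
    if "s \<le> l" for s
  proof -
    have "(\<Sum>i\<le>l. B i * real (i choose s)) = (\<Sum>i = s..l. B i * real (i choose s))"
      by (rule sum.mono_neutral_right) (auto simp: binomial_eq_0)
    also have "\<dots> = (\<Sum>j\<le>l - s. B (s + j) * real ((s + j) choose s))"
      using that by (intro sum.reindex_bij_witness[of _ "\<lambda>j. s + j" "\<lambda>i. i - s"]) auto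
    also have "\<dots> = (\<Sum>j\<le>l - s. (- 1) ^ (l - s + j) * real ((l + m) choose (l - s - j))
        * real ((l + n + m + s + j) choose j) * (fact (l + n + m + s) / (fact (l + n + m) * fact s)))"
    proof (rule sum.cong)
      fix j assume "j \<in> {..l - s}"
      then have j: "s + j \<le> l" using that by auto
      have sgn: "(- 1 :: real) ^ (l + (s + j)) = (- 1) ^ (l - s + j)"
      proof -
        have "l + (s + j) = (l - s + j) + 2 * s" using that by simp
        then show ?thesis by (simp only: power_add power_mult) simp
      qed
      have "l + m - (l - s - j) = m + (s + j)" "l - s - j = l - (s + j)" using j by auto
      then show "B (s + j) * real ((s + j) choose s) = (- 1) ^ (l - s + j) * real ((l + m) choose (l - s - j))
        * real ((l + n + m + s + j) choose j) * (fact (l + n + m + s) / (fact (l + n + m) * fact s))"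
        unfolding B_def sgn by (simp add: binomial_fact add_ac mult_ac)
    qed simp
    also have "\<dots> = real ((n + l) choose (l - s)) * (fact (l + n + m + s) / (fact (l + n + m) * fact s))"
      unfolding sum_distrib_right[symmetric] sum_alternating_binomial_product[OF that] ..
    finally show ?thesis .
  qed
  have pow: "((1 + x) / 2) ^ i = (\<Sum>s\<le>l. real (i choose s) * (- z) ^ s)" if "i \<le> l" for i
  proof -
    have "((1 + x) / 2) ^ i = (- z + 1) ^ i" by (simp add: z_def field_simps)
    also have "\<dots> = (\<Sum>s\<le>i. real (i choose s) * (- z) ^ s)" unfolding binomial_ring by simp
    also have "\<dots> = (\<Sum>s\<le>l. real (i choose s) * (- z) ^ s)"
      using that by (intro sum.mono_neutral_left) (auto simp: binomial_eq_0)
    finally show ?thesis .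
  qed
  have "(\<Sum>i\<le>l. B i * ((1 + x) / 2) ^ i) = (\<Sum>i\<le>l. \<Sum>s\<le>l. B i * real (i choose s) * (- z) ^ s)"
    by (intro sum.cong) (auto simp: pow sum_distrib_left mult.assoc)
  also have "\<dots> = (\<Sum>s\<le>l. (\<Sum>i\<le>l. B i * real (i choose s)) * (- z) ^ s)"
    by (subst sum.swap) (simp add: sum_distrib_right)
  also have "\<dots> = jacobi_P l (real n) (real m) x"
    unfolding jacobi_P_eq_sum
    by (intro sum.cong) (auto simp: coeff z_def[symmetric] power_minus[of z])
  finally show ?thesis unfolding B_def by simp
qed

section \<open>The integral in the variable t\<close>

text \<open>Termwise integration gives \<open>c ^ m\<close> times a polynomial in
  \<open>c\<^sup>2\<close>. For x = 2 c^2 - 1 one has (1 + x) / 2 = c^2, so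
  \<open>jacobi_P_reflected\<close> can be matched term by term.\<close>

lemma has_integral_gegenbauer_C:
  fixes c :: real
  shows "((\<lambda>t. cos (real m * t) * gegenbauer_C (2 * l + m) (real n + 1) (c * cos t)) has_integral
     pi * fact (l + n + m) / (2 * fact n * fact (l + m)) * c ^ m
       * jacobi_P l (real n) (real m) (2 * c\<^sup>2 - 1)) {0..pi / 2}"
proof -
  define k where "k = 2 * l + m"
  define a :: "nat \<Rightarrow> real" where
    "a i = (- (real n + 1) gchoose i) * real (i choose (k - i)) * (- 2 * c) ^ (2 * i - k)" for i
  define I where "I i = a i * (pi / 2 ^ (2 * i - k + 1) * real ((2 * i - k) choose (i - l)))" for i
  have "((\<lambda>t. a i * (cos (real m * t) * cos t ^ (2 * i - k))) has_integral I i) {0..pi / 2}" for i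
  proof (cases "k \<le> 2 * i")
    case True
    \<comment> \<open>The moment index \<open>i - l\<close> is chosen to produce frequency -m, and
      cosine is even. Here \<open>k \<le> 2 * i\<close> forces \<open>l \<le> i\<close>, so neither
      subtraction truncates.\<close>
    have eq: "real (2 * i - k) - 2 * real (i - l) = - real m"
      using True by (simp add: k_def of_nat_diff)
    show ?thesis
      using has_integral_mult_right[OF has_integral_cos_mult_cos_power[of "2 * i - k" "i - l"], of "a i"]
      unfolding I_def eq by simp
  next
    case False
    then show ?thesis by (simp add: a_def I_def binomial_eq_0)
  qed
  then have "((\<lambda>t. \<Sum>i\<le>k. a i * (cos (real m * t) * cos t ^ (2 * i - k))) has_integral (\<Sum>i\<le>k. I i)) {0..pi / 2}"
    by (intro has_integral_sum) auto
  moreover have "(\<Sum>i\<le>k. a i * (cos (real m * t) * cos t ^ (2 * i - k)))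
      = cos (real m * t) * gegenbauer_C k (real n + 1) (c * cos t)" for t
  proof -
    have "(- 2 * (c * cos t)) ^ e = (- 2 * c) ^ e * cos t ^ e" for e
      by (simp only: power_mult_distrib[symmetric] mult.assoc)
    then show ?thesis
      unfolding gegenbauer_C_eq_sum a_def sum_distrib_left by (simp only: mult_ac)
  qed
  moreover have "(\<Sum>i\<le>k. I i) = pi * fact (l + n + m) / (2 * fact n * fact (l + m)) * c ^ m
       * jacobi_P l (real n) (real m) (2 * c\<^sup>2 - 1)"
  proof -
    \<comment> \<open>Below \<open>l + m\<close> one binomial always vanishes:
      \<open>i choose (k - i)\<close> if \<open>2 * i < k\<close>, and otherwise the moment's,
      because then \<open>i - l > 2 * i - k\<close>.\<close>
    have "(\<Sum>i\<le>k. I i) = (\<Sum>i = l + m..k. I i)"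
      by (rule sum.mono_neutral_right) (auto simp: I_def a_def k_def binomial_eq_0)
    also have "\<dots> = (\<Sum>t\<le>l. I (l + m + t))"
      by (intro sum.reindex_bij_witness[of _ "\<lambda>t. l + m + t" "\<lambda>i. i - (l + m)"]) (auto simp: k_def)
    also have "\<dots> = (\<Sum>t\<le>l. pi * fact (l + n + m) / (2 * fact n * fact (l + m)) * c ^ m *
        ((- 1) ^ (l + t) * fact (l + n + m + t) * fact (l + m)
        / (fact (l + n + m) * fact (l - t) * fact t * fact (m + t)) * (c\<^sup>2) ^ t))"
    proof (rule sum.cong)
      fix t assume "t \<in> {..l}"
      then have t: "t \<le> l" by simp
      have e: "2 * (l + m + t) - k = m + 2 * t" "k - (l + m + t) = l - t" "l + m + t - l = m + t"
        "l + m + t - (l - t) = m + 2 * t" "m + 2 * t - (m + t) = t"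
        using t by (auto simp: k_def)
      have "I (l + m + t) = (- 1) ^ (l + m + t) * real ((n + (l + m + t)) choose (l + m + t))
          * real ((l + m + t) choose (l - t)) * ((- 2 * c) ^ (m + 2 * t) * pi / 2 ^ (m + 2 * t + 1))
          * real ((m + 2 * t) choose (m + t))"
        unfolding I_def a_def gbinomial_minus_Suc e by simp
      also have "(- 2 * c) ^ (m + 2 * t) * pi / 2 ^ (m + 2 * t + 1) = (- 1) ^ m * c ^ m * (c\<^sup>2) ^ t * pi / 2"
      proof -
        have "(- 2 * c) ^ (m + 2 * t) = (- 1) ^ m * 2 ^ (m + 2 * t) * c ^ m * (c\<^sup>2) ^ t"
          by (simp add: power_mult_distrib power_add power_mult power_minus[of "2 * c"] power_minus[of 2])
        then show ?thesis by simp
      qed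
      also have "real ((n + (l + m + t)) choose (l + m + t)) = fact (l + n + m + t) / (fact (l + m + t) * fact n)"
        by (simp add: binomial_fact add_ac)
      also have "real ((l + m + t) choose (l - t)) = fact (l + m + t) / (fact (l - t) * fact (m + 2 * t))"
        by (subst binomial_fact) (auto simp only: e)
      also have "real ((m + 2 * t) choose (m + t)) = fact (m + 2 * t) / (fact (m + t) * fact t)"
        by (subst binomial_fact) (auto simp only: e)
      \<comment> \<open>This (-1)^m cancels the one from the power of
        \<open>- 2 * c\<close>.\<close>
      also have "(- 1 :: real) ^ (l + m + t) = (- 1) ^ m * (- 1) ^ (l + t)"
        by (simp add: power_add)
      finally show "I (l + m + t) = pi * fact (l + n + m) / (2 * fact n * fact (l + m)) * c ^ m *
        ((- 1) ^ (l + t) * fact (l + n + m + t) * fact (l + m)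
        / (fact (l + n + m) * fact (l - t) * fact t * fact (m + t)) * (c\<^sup>2) ^ t)"
        by (cases "even m") (simp_all add: field_simps)
    qed simp
    also have "\<dots> = pi * fact (l + n + m) / (2 * fact n * fact (l + m)) * c ^ m
       * jacobi_P l (real n) (real m) (2 * c\<^sup>2 - 1)"
      unfolding jacobi_P_reflected sum_distrib_left by simp
    finally show ?thesis .
  qed
  ultimately show ?thesis unfolding k_def by simp
qed

section \<open>The substitution t = arccos(cos u / cos \<theta>)\<close>

lemma arccos_cos_ratio:
  assumes "0 \<le> \<theta>" "\<theta> < pi / 2"
  shows "continuous_on {\<theta>..pi / 2} (\<lambda>u. arccos (cos u / cos \<theta>))"
    and "(\<lambda>u. arccos (cos u / cos \<theta>)) ` {\<theta>..pi / 2} \<subseteq> {0..pi / 2}"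
proof -
  have c: "cos \<theta> > 0" using assms by (intro cos_gt_zero_pi) auto
  have ran: "0 \<le> cos u / cos \<theta> \<and> cos u / cos \<theta> \<le> 1" if "u \<in> {\<theta>..pi / 2}" for u
    using that assms c cos_ge_zero[of u] cos_monotone_0_pi_le[of \<theta> u] by simp
  then have "\<forall>u\<in>{\<theta>..pi / 2}. - 1 \<le> cos u / cos \<theta> \<and> cos u / cos \<theta> \<le> 1"
    by (meson neg_le_0_iff_le order_trans zero_le_one)
  with c show "continuous_on {\<theta>..pi / 2} (\<lambda>u. arccos (cos u / cos \<theta>))"
    by (intro continuous_on_arccos continuous_intros) auto
  show "(\<lambda>u. arccos (cos u / cos \<theta>)) ` {\<theta>..pi / 2} \<subseteq> {0..pi / 2}"
  proof (rule image_subsetI)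
    fix u assume "u \<in> {\<theta>..pi / 2}"
    then have "0 \<le> cos u / cos \<theta>" "cos u / cos \<theta> \<le> 1" using ran by blast+
    then show "arccos (cos u / cos \<theta>) \<in> {0..pi / 2}"
      using arccos_lbound[of "cos u / cos \<theta>"] arccos_le_pi2[of "cos u / cos \<theta>"] by auto
  qed
qed

text \<open>The singular kernel is exactly the derivative of
  \<open>arccos (cos u / cos \<theta>)\<close>, which runs from 0 to \<open>pi / 2\<close>.\<close>

lemma has_integral_arccos_substitution:
  fixes h :: "real \<Rightarrow> real"
  assumes "0 \<le> \<theta>" "\<theta> < pi / 2" "continuous_on {0..pi / 2} h"
  shows "((\<lambda>u. sin u / sqrt ((cos \<theta>)\<^sup>2 - (cos u)\<^sup>2) * h (arccos (cos u / cos \<theta>)))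
           has_integral integral {0..pi / 2} h) {\<theta>..pi / 2}"
proof -
  have c: "cos \<theta> > 0" using assms by (intro cos_gt_zero_pi) auto
  \<comment> \<open>The substitution rule gives an oriented integral; its second part is over the
    empty interval from \<open>pi / 2\<close> down to 0.\<close>
  have "((\<lambda>u. (sin u / sqrt ((cos \<theta>)\<^sup>2 - (cos u)\<^sup>2)) *\<^sub>R h (arccos (cos u / cos \<theta>)))
      has_integral (integral {arccos (cos \<theta> / cos \<theta>)..arccos (cos (pi / 2) / cos \<theta>)} h
        - integral {arccos (cos (pi / 2) / cos \<theta>)..arccos (cos \<theta> / cos \<theta>)} h)) {\<theta>..pi / 2}"
  \<comment> \<open>At \<open>u = \<theta>\<close> the ratio is 1, where arccos is not
    differentiable, so this point is the exceptional set.\<close>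
  proof (rule has_integral_substitution_general[where s = "{\<theta>}" and c = 0 and d = "pi / 2"])
    show "(\<lambda>u. arccos (cos u / cos \<theta>)) ` {\<theta>..pi / 2} \<subseteq> {0..pi / 2}"
      "continuous_on {\<theta>..pi / 2} (\<lambda>u. arccos (cos u / cos \<theta>))"
      using arccos_cos_ratio[OF assms(1,2)] by auto
    fix u assume u: "u \<in> {\<theta>..pi / 2} - {\<theta>}"
    then have lt: "cos u < cos \<theta>" "0 \<le> cos u"
      using assms by (auto intro!: cos_monotone_0_pi cos_ge_zero)
    have r: "- 1 < cos u / cos \<theta>" "cos u / cos \<theta> < 1" using lt c by (auto simp: field_simps)
    have "sqrt (1 - (cos u / cos \<theta>)\<^sup>2) = sqrt ((cos \<theta>)\<^sup>2 - (cos u)\<^sup>2) / cos \<theta>"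
      using c by (simp add: field_simps real_sqrt_divide flip: real_sqrt_mult)
    moreover have "((\<lambda>u. arccos (cos u / cos \<theta>)) has_real_derivative
        (- sin u / cos \<theta>) * inverse (- sqrt (1 - (cos u / cos \<theta>)\<^sup>2))) (at u)"
      using r c by (auto intro!: derivative_eq_intros)
    ultimately have "((\<lambda>u. arccos (cos u / cos \<theta>)) has_real_derivative
        sin u / sqrt ((cos \<theta>)\<^sup>2 - (cos u)\<^sup>2)) (at u)"
      using c by (simp add: field_simps)
    then show "((\<lambda>u. arccos (cos u / cos \<theta>)) has_real_derivative
        sin u / sqrt ((cos \<theta>)\<^sup>2 - (cos u)\<^sup>2)) (at u within {\<theta>..pi / 2})"
      by (rule DERIV_subset) simp
  qed (use assms in auto)
  then show ?thesis using c by simp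
qed

text \<open>The kernel is nonnegative and integrable (the case \<open>h = 1\<close> of the
  substitution), hence absolutely integrable; a bounded continuous factor preserves this. At
  \<open>u = \<theta>\<close> the kernel is 0, as a division by zero.\<close>

lemma absolutely_integrable_arccos_substitution:
  fixes h :: "real \<Rightarrow> real"
  assumes "0 \<le> \<theta>" "\<theta> < pi / 2" "continuous_on {0..pi / 2} h"
  shows "(\<lambda>u. sin u / sqrt ((cos \<theta>)\<^sup>2 - (cos u)\<^sup>2) * h (arccos (cos u / cos \<theta>)))
           absolutely_integrable_on {\<theta>..pi / 2}"
proof -
  have c: "cos \<theta> > 0" using assms by (intro cos_gt_zero_pi) auto
  have cont: "continuous_on {\<theta>..pi / 2} (\<lambda>u. h (arccos (cos u / cos \<theta>)))"
  proof (rule continuous_on_compose2[OF assms(3)])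
    show "(\<lambda>u. arccos (cos u / cos \<theta>)) ` {\<theta>..pi / 2} \<subseteq> {0..pi / 2}"
      "continuous_on {\<theta>..pi / 2} (\<lambda>u. arccos (cos u / cos \<theta>))"
      using arccos_cos_ratio[OF assms(1,2)] by auto
  qed
  have "(\<lambda>u. sin u / sqrt ((cos \<theta>)\<^sup>2 - (cos u)\<^sup>2)) absolutely_integrable_on {\<theta>..pi / 2}"
  proof (rule nonnegative_absolutely_integrable_1)
    show "(\<lambda>u. sin u / sqrt ((cos \<theta>)\<^sup>2 - (cos u)\<^sup>2)) integrable_on {\<theta>..pi / 2}"
      using has_integral_arccos_substitution[OF assms(1,2), of "\<lambda>_. 1"] by (auto simp: integrable_on_def)
    fix u assume u: "u \<in> {\<theta>..pi / 2}"
    have "0 \<le> sin u" using u assms by (intro sin_ge_zero) auto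
    moreover have "(cos u)\<^sup>2 \<le> (cos \<theta>)\<^sup>2"
      using u assms by (intro power_mono cos_monotone_0_pi_le cos_ge_zero) auto
    ultimately show "0 \<le> sin u / sqrt ((cos \<theta>)\<^sup>2 - (cos u)\<^sup>2)" by simp
  qed
  then have "(\<lambda>u. h (arccos (cos u / cos \<theta>)) * (sin u / sqrt ((cos \<theta>)\<^sup>2 - (cos u)\<^sup>2)))
      absolutely_integrable_on {\<theta>..pi / 2}"
    by (intro absolutely_integrable_bounded_measurable_product_real
          continuous_imp_measurable_on_sets_lebesgue cont compact_imp_bounded
          compact_continuous_image) auto
  then show ?thesis by (simp add: mult.commute)
qed

theorem theorem2p6:
  fixes n m l :: nat and \<theta> :: real
  assumes "0 \<le> \<theta>" and "\<theta> < pi / 2"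
  shows "let f = (\<lambda>u::real. sin u / sqrt ((cos \<theta>)\<^sup>2 - (cos u)\<^sup>2)
                    * hyp2F1 (- real m) (real m) (1 / 2) ((cos \<theta> - cos u) / (2 * cos \<theta>))
                    * gegenbauer_C (2 * l + m) (real n + 1) (cos u))
         in f absolutely_integrable_on {\<theta>..pi / 2} \<and>
            jacobi_P l (real n) (real m) (cos (2 * \<theta>)) =
              2 * fact n * fact (l + m) / (pi * fact (l + n + m)) * (1 / cos \<theta> ^ m)
                * integral {\<theta>..pi / 2} f"
proof -
  define f where "f = (\<lambda>u. sin u / sqrt ((cos \<theta>)\<^sup>2 - (cos u)\<^sup>2)
                    * hyp2F1 (- real m) (real m) (1 / 2) ((cos \<theta> - cos u) / (2 * cos \<theta>))
                    * gegenbauer_C (2 * l + m) (real n + 1) (cos u))"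
  define h where "h = (\<lambda>t. cos (real m * t) * gegenbauer_C (2 * l + m) (real n + 1) (cos \<theta> * cos t))"
  have c: "cos \<theta> > 0" using assms by (intro cos_gt_zero_pi) auto
  have h: "continuous_on {0..pi / 2} h"
    unfolding h_def gegenbauer_C_eq_sum by (intro continuous_intros)
  have eq: "sin u / sqrt ((cos \<theta>)\<^sup>2 - (cos u)\<^sup>2) * h (arccos (cos u / cos \<theta>)) = f u"
    if "u \<in> {\<theta>..pi / 2}" for u
  proof -
    have "- 1 \<le> cos u / cos \<theta>" "cos u / cos \<theta> \<le> 1"
      using that assms c cos_ge_zero[of u] cos_monotone_0_pi_le[of \<theta> u] by (auto simp: field_simps)
    then have t: "cos (arccos (cos u / cos \<theta>)) = cos u / cos \<theta>" by (rule cos_arccos)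
    \<comment> \<open>With cos t = cos u / cos \<theta> the hypergeometric argument becomes (1 - cos
      t) / 2, as in \<open>hyp2F1_chebyshev\<close>.\<close>
    have "(cos \<theta> - cos u) / (2 * cos \<theta>) = (1 - cos u / cos \<theta>) / 2"
      using c by (simp add: field_simps)
    then have "cos (real m * arccos (cos u / cos \<theta>))
        = hyp2F1 (- real m) (real m) (1 / 2) ((cos \<theta> - cos u) / (2 * cos \<theta>))"
      by (simp only: hyp2F1_chebyshev[symmetric] t)
    then show ?thesis
      using c unfolding f_def h_def t by simp
  qed
  have "f absolutely_integrable_on {\<theta>..pi / 2}"
    using absolutely_integrable_arccos_substitution[OF assms h]
    by (rule set_integrable_cong[THEN iffD1, rotated 3]) (use eq in auto)
  moreover have "integral {\<theta>..pi / 2} f = integral {0..pi / 2} h"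
    using has_integral_arccos_substitution[OF assms h]
    by (intro integral_unique) (rule has_integral_eq[OF eq])
  moreover have "integral {0..pi / 2} h = pi * fact (l + n + m) / (2 * fact n * fact (l + m)) * cos \<theta> ^ m
       * jacobi_P l (real n) (real m) (cos (2 * \<theta>))"
    unfolding h_def cos_double_cos by (intro integral_unique has_integral_gegenbauer_C)
  \<comment> \<open>The prefactor is nonzero because \<open>cos \<theta> > 0\<close>, so the
    equation can be solved for the Jacobi polynomial.\<close>
  ultimately show ?thesis
    using c unfolding f_def[symmetric] Let_def by simp
qed

end
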